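(* Let $D_0$ be a two-row diagram whose nonempty rows are $r_1<r_2$. Then $$|Min(D_0)|=\begin{cases}|\mathrm{Col}^{\leftarrow}(D_0;r_1)|+1,& r_1>1,\\ 1,& r_1=1.\end{cases}$$
   Context: A diagram is a finite set $D$ of cells $(r,c)$ with $r,c$ positive integers; $r$ is the row (rows numbered from bottom to top starting at 1) and $c$ the column (numbered from left to right starting at 1). A Kohnert move at row $r$ applied to a diagram $D$: if row $r$ of $D$ is empty, $D$ is unchanged; otherwise let $(r,c)$ be the cell of row $r$ with the largest column index; if every position $(r',c)$ with $1\le r'<r$ belongs to $D$, then $D$ is unchanged; otherwise let $r'$ be the largest integer with $1\le r'<r$ and $(r',c)\notin D$, and the move replaces the cell $(r,c)$ by $(r',c)$. For a diagram $D_0$, $KD(D_0)$ is the set of all diagrams obtainable from $D_0$ by finite (possibly empty) sequences of Kohnert moves; the Kohnert poset $\mathcal{P}(D_0)$ is $KD(D_0)$ ordered by $D_2\preceq D_1$ iff $D_2$ can be obtained from $D_1$ by a finite sequence of Kohnert moves; $Min(D_0)$ is its set of minimal elements. A two-row diagram is a diagram with exactly two nonempty rows (not necessarily consecutive). For such $D_0$ with nonempty rows $r_1<r_2$: $\mathrm{Col}(D_0;r_1,r_2)$ is the set of columns containing cells in both rows; for $i=1,2$, $\mathrm{Col}(D_0;r_i)$ is the set of columns containing a cell only in row $r_i$; $\mathrm{Col}^{\leftarrow}(D_0;r_i)=\{c\in\mathrm{Col}(D_0;r_i): c<\max\mathrm{Col}(D_0;r_1,r_2)\}$ and $\mathrm{Col}^{\rightarrow}(D_0;r_i)=\{c\in\mathrm{Col}(D_0;r_i):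 c>\max\mathrm{Col}(D_0;r_1,r_2)\}$, both taken to be empty when $\mathrm{Col}(D_0;r_1,r_2)=\emptyset$. *)

theory Defs
  imports Main
begin

text \<open>A cell is a pair (row, column); rows are numbered from bottom to top, columns from left
  to right, both starting at 1.\<close>

type_synonym cell = "nat \<times> nat"

definition is_diagram :: "cell set \<Rightarrow> bool" where
  "is_diagram D \<longleftrightarrow> finite D \<and> (\<forall>(r, c) \<in> D. 1 \<le> r \<and> 1 \<le> c)"

definition row_cols :: "cell set \<Rightarrow> nat \<Rightarrow> nat set" where
  "row_cols D r = {c. (r, c) \<in> D}"

definition nonempty_rows :: "cell set \<Rightarrow> nat set" where
  "nonempty_rows D = {r. row_cols D r \<noteq> {}}"

definition empty_below :: "cell set \<Rightarrow> nat \<Rightarrow> nat \<Rightarrow> nat set" where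
  "empty_below D r c = {r'. 1 \<le> r' \<and> r' < r \<and> (r', c) \<notin> D}"

definition kohnert_move :: "nat \<Rightarrow> cell set \<Rightarrow> cell set" where
  "kohnert_move r D =
     (if row_cols D r = {} then D
      else let c = Max (row_cols D r) in
        if empty_below D r c = {} then D
        else insert (Max (empty_below D r c), c) (D - {(r, c)}))"

definition kohnert_step :: "cell set \<Rightarrow> cell set \<Rightarrow> bool" where
  "kohnert_step D D' \<longleftrightarrow> (\<exists>r \<ge> 1. D' = kohnert_move r D)"

text \<open>The smaller diagram is the one obtained by applying moves to the larger one.\<close>

definition kohnert_le :: "cell set \<Rightarrow> cell set \<Rightarrow> bool"  (infix \<open>\<preceq>\<^sub>K\<close> 50) where
  "D2 \<preceq>\<^sub>K D1 \<longleftrightarrow> kohnert_step\<^sup>*\<^sup>* D1 D2"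

definition KD :: "cell set \<Rightarrow> cell set set" where
  "KD D0 = {D. kohnert_step\<^sup>*\<^sup>* D0 D}"

definition Min_KD :: "cell set \<Rightarrow> cell set set" where
  "Min_KD D0 = {D \<in> KD D0. \<forall>E \<in> KD D0. E \<preceq>\<^sub>K D \<longrightarrow> E = D}"

definition Col_both :: "cell set \<Rightarrow> nat \<Rightarrow> nat \<Rightarrow> nat set" where
  "Col_both D r1 r2 = {c. (r1, c) \<in> D \<and> (r2, c) \<in> D}"

definition Col_only :: "cell set \<Rightarrow> nat \<Rightarrow> nat set" where
  "Col_only D r = {c. (r, c) \<in> D \<and> (\<forall>r'. r' \<noteq> r \<longrightarrow> (r', c) \<notin> D)}"

text \<open>In \<open>Col_left D r1 r2 r\<close>, the arguments \<open>r1\<close> and \<open>r2\<close> are the two nonempty rows and \<open>r\<close> is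
  one of them. The empty case is separate because \<open>Max {}\<close> is unspecified.\<close>

definition Col_left :: "cell set \<Rightarrow> nat \<Rightarrow> nat \<Rightarrow> nat \<Rightarrow> nat set" where
  "Col_left D r1 r2 r =
     (if Col_both D r1 r2 = {} then {}
      else {c \<in> Col_only D r. c < Max (Col_both D r1 r2)})"

end

(* Every column holds at most two cells, so a minimal diagram lives in rows 1 and 2 and the last
   cell of its row 2 lies in the last column M occupied by both rows of D0 (row 2 is empty if there
   is no such column).  A cell that is alone
   in its column descends one row at a time, and not while a cell further right shares its row;
   hence it never passes below the cells of a column to its right that start weakly below it.
   Consequently the upper singles left of M end in row 2, all singles right of M end in row 1,
   and the lower singles left of M that end in row 2 form an initial segment of
   Col_left D0 r1 r2 r1, which determines the minimal diagram.  If r1 = 1,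
   the lower singles never move and the segment is empty.  If r1 > 1, every initial segment
   occurs: lower row r1 to row 2, then the part of it beyond the segment to row 1, and finally
   the part of row r2 from column M on to row 2, which blocks the segment. *)

theory Submission
  imports Defs
begin

section \<open>Kohnert moves\<close>

lemma Max_empty_below:
  assumes "empty_below D r c \<noteq> {}"
  defines "k \<equiv> Max (empty_below D r c)"
  shows "1 \<le> k" "k < r" "(k, c) \<notin> D" "\<And>j. k < j \<Longrightarrow> j < r \<Longrightarrow> (j, c) \<in> D"
proof -
  have fin: "finite (empty_below D r c)"
    by (rule finite_subset[of _ "{..<r}"]) (auto simp: empty_below_def)
  have "k \<in> empty_below D r c"
    using Max_in[OF fin assms(1)] by (simp add: k_def)
  then show "1 \<le> k" "k < r" "(k, c) \<notin> D"
    by (auto simp: empty_below_def)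
  fix j assume "k < j" "j < r"
  then have "j \<notin> empty_below D r c"
    using Max_ge[OF fin, of j] by (auto simp: k_def)
  then show "(j, c) \<in> D"
    using \<open>k < j\<close> \<open>j < r\<close> by (auto simp: empty_below_def)
qed

lemma finite_row_cols: "finite D \<Longrightarrow> finite (row_cols D r)"
  by (rule finite_subset[of _ "snd ` D"]) (force simp: row_cols_def)+

lemma Max_row_cols:
  assumes "finite D" "row_cols D r \<noteq> {}"
  shows "(r, Max (row_cols D r)) \<in> D"
    and "\<And>c. (r, c) \<in> D \<Longrightarrow> c \<le> Max (row_cols D r)"
  using Max_in[OF finite_row_cols[OF assms(1)] assms(2)] Max_ge[OF finite_row_cols[OF assms(1)]]
  by (auto simp: row_cols_def)

text \<open>Excludes both ways in which a move can be idle, an empty row and a column full below the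
  cell, so that later proofs meet idle moves only as \<open>D' = D\<close>.\<close>

lemma kohnert_stepE:
  assumes "kohnert_step D D'" "finite D" "D' \<noteq> D"
  obtains r c k where "1 \<le> k" "k < r" "(r, c) \<in> D" "\<And>c'. (r, c') \<in> D \<Longrightarrow> c' \<le> c"
    "(k, c) \<notin> D" "\<And>j. k < j \<Longrightarrow> j < r \<Longrightarrow> (j, c) \<in> D" "D' = insert (k, c) (D - {(r, c)})"
proof -
  obtain r where D': "D' = kohnert_move r D"
    using assms(1) by (auto simp: kohnert_step_def)
  have ne: "row_cols D r \<noteq> {}"
    using D' assms(3) by (auto simp: kohnert_move_def)
  define c where "c = Max (row_cols D r)"
  have eb: "empty_below D r c \<noteq> {}"
    using D' assms(3) ne by (auto simp: kohnert_move_def c_def Let_def)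
  show thesis
  proof (rule that[OF Max_empty_below(1,2)[OF eb] _ _ Max_empty_below(3,4)[OF eb]])
    show "(r, c) \<in> D" "\<And>c'. (r, c') \<in> D \<Longrightarrow> c' \<le> c"
      using Max_row_cols[OF assms(2) ne] by (auto simp: c_def)
    show "D' = insert (Max (empty_below D r c), c) (D - {(r, c)})"
      using D' ne eb by (simp add: kohnert_move_def c_def Let_def)
  qed
qed

lemma kohnert_step_down:
  assumes "finite D" "1 \<le> k" "(Suc k, c) \<in> D" "\<And>c'. (Suc k, c') \<in> D \<Longrightarrow> c' \<le> c" "(k, c) \<notin> D"
  shows "kohnert_step D (insert (k, c) (D - {(Suc k, c)}))"
proof -
  have ne: "row_cols D (Suc k) \<noteq> {}"
    using assms(3) by (auto simp: row_cols_def)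
  have c: "Max (row_cols D (Suc k)) = c"
    using assms(3,4) by (intro Max_eqI finite_row_cols assms(1)) (auto simp: row_cols_def)
  have k: "k \<in> empty_below D (Suc k) c"
    using assms(2,5) by (simp add: empty_below_def)
  have "Max (empty_below D (Suc k) c) = k"
    by (rule Max_eqI[OF finite_subset[of _ "{..k}"] _ k]) (auto simp: empty_below_def)
  then have "insert (k, c) (D - {(Suc k, c)}) = kohnert_move (Suc k) D"
    using ne c k by (auto simp: kohnert_move_def Let_def)
  then show ?thesis
    unfolding kohnert_step_def by (metis Suc_leI zero_less_Suc One_nat_def)
qed

lemma kohnert_step_finite:
  assumes "kohnert_step D D'" "finite D"
  shows "finite D'"
proof (cases "D' = D")
  case False
  show ?thesis
    by (rule kohnert_stepE[OF assms False]) (simp add: assms(2))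
qed (simp add: assms)

lemma kohnert_step_row_one:
  assumes "kohnert_step D D'" "finite D" "(1, c) \<in> D"
  shows "(1, c) \<in> D'"
proof (cases "D' = D")
  case False
  show ?thesis
    by (rule kohnert_stepE[OF assms(1,2) False]) (use assms(3) in auto)
qed (use assms in simp)

section \<open>Invariants of a single move\<close>

definition col_rows :: "cell set \<Rightarrow> nat \<Rightarrow> nat set" where
  "col_rows D c = {r. (r, c) \<in> D}"

lemma finite_col_rows: "finite D \<Longrightarrow> finite (col_rows D c)"
  by (rule finite_subset[of _ "fst ` D"]) (force simp: col_rows_def)+

text \<open>A move stays within one column and lands on a free position.\<close>

lemma kohnert_step_card_col_rows:
  assumes "kohnert_step D D'" "finite D"
  shows "card (col_rows D' c) = card (col_rows D c)"
proof (cases "D' = D")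
  case False
  show ?thesis
  proof (rule kohnert_stepE[OF assms False])
    fix r c' k
    assume *: "(r, c') \<in> D" "(k, c') \<notin> D" "D' = insert (k, c') (D - {(r, c')})"
    show ?thesis
    proof (cases "c = c'")
      case True
      then have "col_rows D' c = insert k (col_rows D c - {r})"
        and "r \<in> col_rows D c" "k \<notin> col_rows D c"
        using * by (auto simp: col_rows_def)
      then show ?thesis
        using finite_col_rows[OF assms(2), of c] card_Suc_Diff1[of "col_rows D c" r] by simp
    next
      case False
      then have "col_rows D' c = col_rows D c"
        using * by (auto simp: col_rows_def)
      then show ?thesis by simp
    qed
  qed
qed simp

text \<open>Supplies the termination measure: one cell drops and the others stay.\<close>

lemma kohnert_step_sum_rows_less:
  assumes "kohnert_step D D'" "finite D" "D' \<noteq> D"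
  shows "sum fst D' < sum fst D"
proof (rule kohnert_stepE[OF assms])
  fix r c k
  assume *: "k < r" "(r, c) \<in> D" "(k, c) \<notin> D" "D' = insert (k, c) (D - {(r, c)})"
  have "sum fst D = r + sum fst (D - {(r, c)})"
    using *(2) assms(2) by (simp add: sum.remove)
  moreover have "sum fst D' = k + sum fst (D - {(r, c)})"
    using * assms(2) by simp
  ultimately show ?thesis
    using *(1) by simp
qed

text \<open>The order between columns that moves cannot reverse when \<open>c\<close> is weakly left
  of \<open>c'\<close> and holds at most one cell. It is vacuous if either column is empty.\<close>

definition dominates :: "cell set \<Rightarrow> nat \<Rightarrow> nat \<Rightarrow> bool" where
  "dominates D c c' \<longleftrightarrow> (\<forall>r r'. (r, c) \<in> D \<longrightarrow> (r', c') \<in> D \<longrightarrow> r' \<le> r)"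

(* dominates D c c says that column c has at most one cell. *)
lemma kohnert_step_dominates:
  assumes "kohnert_step D D'" "finite D" "c \<le> c'" "dominates D c c" "dominates D c c'"
  shows "dominates D' c c'"
proof (cases "D' = D")
  case False
  show ?thesis
  proof (rule kohnert_stepE[OF assms(1,2) False])
    fix r d k
    assume k: "k < r" and rd: "(r, d) \<in> D" and last: "\<And>e. (r, e) \<in> D \<Longrightarrow> e \<le> d"
      and full: "\<And>j. k < j \<Longrightarrow> j < r \<Longrightarrow> (j, d) \<in> D"
      and D': "D' = insert (k, d) (D - {(r, d)})"
    have single: "i = j" if "(i, c) \<in> D" "(j, c) \<in> D" for i j
      using assms(4) that unfolding dominates_def by (meson le_antisym)
    show ?thesis
    proof (cases "d = c")
      case True
      \<comment> \<open>A drop of more than one row would have to pass a second cell of column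
        \<open>c\<close>.\<close>
      have r: "r = Suc k"
        using full[of "Suc k"] rd single True k by fastforce
      \<comment> \<open>The moved cell is the last of its row, so column \<open>c'\<close> has no
        other cell in row \<open>r\<close>. Its cells are thus at least one row lower, which leaves
        room for a drop by one. The second premise covers \<open>c' = c\<close>.\<close>
      have "i \<le> k" if "(i, c') \<in> D" "(i, c') \<noteq> (r, c)" for i
      proof -
        have "i \<le> r"
          using assms(5) rd that True by (auto simp: dominates_def)
        moreover have "i \<noteq> r"
          using last[of c'] that True assms(3) by auto
        ultimately show ?thesis using r by simp
      qed
      then have "i \<le> k" if "(i, c') \<in> D'" for i
        using that True D' by blast
      moreover have "i = k" if "(i, c) \<in> D'" for i
        using that single rd True D' by auto
      ultimately show ?thesis
        unfolding dominates_def by blast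
    next
      case False
      \<comment> \<open>Column \<open>c\<close> is unchanged, and a move in column \<open>c'\<close>
        only lowers a cell there.\<close>
      then show ?thesis
        using assms(5) D' rd k by (fastforce simp: dominates_def)
    qed
  qed
qed (simp add: assms)

section \<open>Invariants along sequences of moves\<close>

lemma kohnert_steps_finite:
  assumes "kohnert_step\<^sup>*\<^sup>* D D'" "finite D"
  shows "finite D'"
  using assms by (induction rule: rtranclp_induct) (auto dest: kohnert_step_finite)

lemma kohnert_steps_row_one:
  assumes "kohnert_step\<^sup>*\<^sup>* D D'" "finite D" "(1, c) \<in> D"
  shows "(1, c) \<in> D'"
  using assms
  by (induction rule: rtranclp_induct) (auto dest: kohnert_step_row_one kohnert_steps_finite)

lemma kohnert_steps_card_col_rows:
  assumes "kohnert_step\<^sup>*\<^sup>* D D'" "finite D"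
  shows "card (col_rows D' c) = card (col_rows D c)"
  using assms(1)
proof (induction rule: rtranclp_induct)
  case (step E F)
  then show ?case
    using kohnert_step_card_col_rows[OF step.hyps(2) kohnert_steps_finite[OF step.hyps(1) assms(2)]]
    by simp
qed simp

lemma kohnert_steps_dominates:
  assumes "kohnert_step\<^sup>*\<^sup>* D D'" "finite D" "c \<le> c'" "dominates D c c" "dominates D c c'"
  shows "dominates D' c c'"
proof -
  \<comment> \<open>The first conjunct carries the condition of at most one cell in column
    \<open>c\<close> through the induction.\<close>
  have "dominates D' c c \<and> dominates D' c c'"
    using assms
    by (induction rule: rtranclp_induct)
      (auto dest: kohnert_step_dominates kohnert_steps_finite)
  then show ?thesis ..
qed

lemma kohnert_steps_sum_rows_less:
  assumes "kohnert_step\<^sup>*\<^sup>* D D'" "finite D" "D' \<noteq> D"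
  shows "sum fst D' < sum fst D"
proof -
  have "D' = D \<or> sum fst D' < sum fst D"
    using assms(1)
  proof (induction rule: rtranclp_induct)
    case (step E F)
    then show ?case
      using kohnert_step_sum_rows_less[of E F] kohnert_steps_finite[OF step.hyps(1) assms(2)]
      by (cases "F = E") auto
  qed simp
  then show ?thesis using assms(3) by simp
qed

section \<open>Minimal diagrams\<close>

text \<open>Among the diagrams reachable from \<open>E\<close>, one with least sum of rows is
  minimal, since any further change would lower the sum.\<close>

lemma Min_KD_below:
  assumes "finite D0" "E \<in> KD D0"
  obtains F where "F \<in> Min_KD D0" "kohnert_step\<^sup>*\<^sup>* E F"
proof -
  obtain F where F: "kohnert_step\<^sup>*\<^sup>* E F"
    and least: "\<And>G. kohnert_step\<^sup>*\<^sup>* E G \<Longrightarrow> sum fst F \<le> sum fst G"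
    using ex_has_least_nat[of "\<lambda>F. kohnert_step\<^sup>*\<^sup>* E F" E "sum fst"] by auto
  have "finite E"
    using assms kohnert_steps_finite by (auto simp: KD_def)
  then have "finite F"
    using F kohnert_steps_finite by blast
  have "F \<in> KD D0"
    using F assms(2) by (auto simp: KD_def)
  moreover have "G = F" if "G \<preceq>\<^sub>K F" for G
  proof (rule ccontr)
    assume "G \<noteq> F"
    have FG: "kohnert_step\<^sup>*\<^sup>* F G"
      using that by (simp add: kohnert_le_def)
    have "sum fst G < sum fst F"
      using kohnert_steps_sum_rows_less[OF FG \<open>finite F\<close> \<open>G \<noteq> F\<close>] .
    then show False
      using least[of G] F FG by (simp add: rtranclp_trans)
  qed
  ultimately have "F \<in> Min_KD D0"
    by (simp add: Min_KD_def)
  then show thesis using F that by blast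
qed

text \<open>Minimality makes every move idle, so nothing is free below the last cell of a nonempty
  row.\<close>

lemma Min_KD_stuck:
  assumes "F \<in> Min_KD D0" "finite D0" "1 \<le> r" "row_cols F r \<noteq> {}" "1 \<le> j" "j \<le> r"
  shows "(j, Max (row_cols F r)) \<in> F"
proof (cases "j = r")
  case True
  have "finite F"
    using assms(1,2) kohnert_steps_finite by (auto simp: Min_KD_def KD_def)
  then show ?thesis
    using Max_row_cols(1) assms(4) True by blast
next
  case False
  define c where "c = Max (row_cols F r)"
  have F: "F \<in> KD D0"
    using assms(1) by (simp add: Min_KD_def)
  have step: "kohnert_step F (kohnert_move r F)"
    using assms(3) by (auto simp: kohnert_step_def)
  then have "kohnert_move r F \<in> KD D0" "kohnert_move r F \<preceq>\<^sub>K F"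
    using F by (auto simp: KD_def kohnert_le_def intro: rtranclp.rtrancl_into_rtrancl)
  then have fixed: "kohnert_move r F = F"
    using assms(1) unfolding Min_KD_def by blast
  have "empty_below F r c = {}"
  proof (rule ccontr)
    assume ne: "empty_below F r c \<noteq> {}"
    then have "kohnert_move r F = insert (Max (empty_below F r c), c) (F - {(r, c)})"
      using assms(4) by (simp add: kohnert_move_def c_def Let_def)
    then show False
      using fixed Max_empty_below(3)[OF ne] by blast
  qed
  then show ?thesis
    using assms(5,6) False by (auto simp: empty_below_def c_def)
qed

section \<open>Lowering part of a row\<close>

text \<open>A map on cells, so that lowering the tail of a row is an image and successive lowerings
  compose.\<close>

definition lower_cell :: "nat \<Rightarrow> nat \<Rightarrow> nat \<Rightarrow> cell \<Rightarrow> cell" where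
  "lower_cell r k m = (\<lambda>(i, c). if i = r \<and> m \<le> c then (k, c) else (i, c))"

text \<open>Only the last cell of a row can move, so the tail is lowered from right to left, by
  induction on its number of cells.\<close>

lemma lower_to_next_row:
  assumes "finite D" "1 \<le> k" "\<And>c. (Suc k, c) \<in> D \<Longrightarrow> m \<le> c \<Longrightarrow> (k, c) \<notin> D"
  shows "kohnert_step\<^sup>*\<^sup>* D (lower_cell (Suc k) k m ` D)"
  using assms
proof (induction "card {c. (Suc k, c) \<in> D \<and> m \<le> c}" arbitrary: D)
  case 0
  have "finite {c. (Suc k, c) \<in> D \<and> m \<le> c}"
    using finite_row_cols[OF \<open>finite D\<close>, of "Suc k"] by (simp add: row_cols_def)
  then have "{c. (Suc k, c) \<in> D \<and> m \<le> c} = {}"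
    using 0(1) by simp
  then have "lower_cell (Suc k) k m x = x" if "x \<in> D" for x
    using that by (auto simp: lower_cell_def split: prod.splits)
  then have "lower_cell (Suc k) k m ` D = D"
    by (simp add: image_cong)
  then show ?case by simp
next
  case (Suc n)
  define C where "C = {c. (Suc k, c) \<in> D \<and> m \<le> c}"
  have fin: "finite C"
    using finite_row_cols[OF \<open>finite D\<close>, of "Suc k"] by (simp add: row_cols_def C_def)
  have card_C: "card C = Suc n"
    using Suc(2) by (simp add: C_def)
  then have "C \<noteq> {}"
    by auto
  define c where "c = Max C"
  have cC: "c \<in> C"
    using Max_in[OF fin \<open>C \<noteq> {}\<close>] by (simp add: c_def)
  then have c: "(Suc k, c) \<in> D" "m \<le> c"
    by (auto simp: C_def)
  \<comment> \<open>Cells left of \<open>m\<close> lie left of the tail, so its last cell is also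
    the last of the whole row.\<close>
  have last: "d \<le> c" if "(Suc k, d) \<in> D" for d
    using Max_ge[OF fin, of d] that c(2) by (cases "m \<le> d") (auto simp: c_def C_def)
  define D' where "D' = insert (k, c) (D - {(Suc k, c)})"
  have step: "kohnert_step D D'"
    unfolding D'_def using kohnert_step_down[of D k c] Suc.prems c last by blast
  have "{d. (Suc k, d) \<in> D' \<and> m \<le> d} = C - {c}"
    by (auto simp: D'_def C_def)
  then have "n = card {d. (Suc k, d) \<in> D' \<and> m \<le> d}"
    using card_C fin cC by simp
  then have "kohnert_step\<^sup>*\<^sup>* D' (lower_cell (Suc k) k m ` D')"
    using Suc.prems by (intro Suc(1)) (auto simp: D'_def)
  moreover have "lower_cell (Suc k) k m ` D' = lower_cell (Suc k) k m ` D"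
  proof -
    \<comment> \<open>The first move anticipates part of the map, hence it does not change the
      image.\<close>
    have "lower_cell (Suc k) k m (k, c) = lower_cell (Suc k) k m (Suc k, c)"
      using c by (simp add: lower_cell_def)
    then have "lower_cell (Suc k) k m ` D' =
        insert (lower_cell (Suc k) k m (Suc k, c)) (lower_cell (Suc k) k m ` (D - {(Suc k, c)}))"
      by (simp add: D'_def)
    also have "\<dots> = lower_cell (Suc k) k m ` D"
      using c(1) by (metis image_insert insert_Diff)
    finally show ?thesis .
  qed
  ultimately show ?case
    using step by (metis converse_rtranclp_into_rtranclp)
qed

text \<open>The tail descends one row at a time through rows that are free in its columns.\<close>

lemma lower_row:
  assumes "k \<le> r" "finite D" "1 \<le> k" "\<And>i c. k \<le> i \<Longrightarrow> i < r \<Longrightarrow> m \<le> c \<Longrightarrow> (i, c) \<notin> D"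
  shows "kohnert_step\<^sup>*\<^sup>* D (lower_cell r k m ` D)"
  using assms
proof (induction r arbitrary: D rule: dec_induct)
  case base
  have "lower_cell k k m = id"
    by (auto simp: lower_cell_def)
  then show ?case by simp
next
  case (step r)
  let ?D = "lower_cell (Suc r) r m ` D"
  have "kohnert_step\<^sup>*\<^sup>* D ?D"
    using step by (intro lower_to_next_row) auto
  moreover have "kohnert_step\<^sup>*\<^sup>* ?D (lower_cell r k m ` ?D)"
  proof (rule step.IH)
    fix i c assume "k \<le> i" "i < r" "m \<le> c"
    then show "(i, c) \<notin> ?D"
      using step.prems(3)[of i c] by (auto simp: lower_cell_def split: if_splits)
  qed (use step.prems in auto)
  \<comment> \<open>Row \<open>r\<close> of \<open>D\<close> has no cell from column
    \<open>m\<close> on, so the second lowering moves exactly the cells that have just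
    arrived.\<close>
  moreover have "lower_cell r k m ` ?D = lower_cell (Suc r) k m ` D"
    unfolding image_image
  proof (rule image_cong[OF refl])
    fix x assume "x \<in> D"
    then show "lower_cell r k m (lower_cell (Suc r) r m x) = lower_cell (Suc r) k m x"
      using step.prems(3)[of r "snd x"] step.hyps by (auto simp: lower_cell_def split: prod.splits)
  qed
  ultimately show ?case by simp
qed

section \<open>Two-row diagrams\<close>

definition initial_segments :: "nat set \<Rightarrow> nat set set" where
  "initial_segments A = {S. S \<subseteq> A \<and> (\<forall>x\<in>A. \<forall>y\<in>S. x \<le> y \<longrightarrow> x \<in> S)}"

text \<open>A nonempty initial segment is determined by its maximum.\<close>

lemma initial_segments_eq:
  assumes "finite A"
  shows "initial_segments A = insert {} ((\<lambda>a. {x \<in> A. x \<le> a}) ` A)"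
proof
  show "initial_segments A \<subseteq> insert {} ((\<lambda>a. {x \<in> A. x \<le> a}) ` A)"
  proof
    fix S assume S: "S \<in> initial_segments A"
    show "S \<in> insert {} ((\<lambda>a. {x \<in> A. x \<le> a}) ` A)"
    proof (cases "S = {}")
      case False
      have "finite S"
        using S assms finite_subset by (auto simp: initial_segments_def)
      then have "Max S \<in> S" "\<And>x. x \<in> S \<Longrightarrow> x \<le> Max S"
        using False by auto
      then have "S = {x \<in> A. x \<le> Max S}" "Max S \<in> A"
        using S unfolding initial_segments_def by blast+
      then show ?thesis by blast
    qed simp
  qed
qed (auto simp: initial_segments_def)

text \<open>Each element cuts off its own nonempty segment; the empty segment is the extra 1 in the
  final formula.\<close>

lemma card_initial_segments:
  assumes "finite A"
  shows "card (initial_segments A) = card A + 1"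
proof -
  have "inj_on (\<lambda>a. {x \<in> A. x \<le> a}) A"
    by (rule inj_onI) (metis (no_types, lifting) mem_Collect_eq order.antisym order.refl)
  then have "card ((\<lambda>a. {x \<in> A. x \<le> a}) ` A) = card A"
    by (rule card_image)
  moreover have "{} \<notin> (\<lambda>a. {x \<in> A. x \<le> a}) ` A"
    by auto
  ultimately show ?thesis
    using assms by (simp add: initial_segments_eq)
qed

section \<open>The initial diagram and its columns\<close>

locale two_row_diagram =
  fixes D0 :: "cell set" and r1 r2 :: nat
  assumes diagram: "is_diagram D0"
    and rows: "nonempty_rows D0 = {r1, r2}"
    and less: "r1 < r2"
begin

abbreviation "A \<equiv> Col_left D0 r1 r2 r1"
abbreviation "B \<equiv> Col_left D0 r1 r2 r2"
abbreviation "both \<equiv> Col_both D0 r1 r2"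

text \<open>The parameter that classifies minimal diagrams. The name refers to row 2 of
  \<open>F\<close>, not to row \<open>r2\<close> of \<open>D0\<close>.\<close>

definition upper :: "cell set \<Rightarrow> nat set" where
  "upper F = {c \<in> A. (2, c) \<in> F}"

lemma finite_D0: "finite D0"
  using diagram by (simp add: is_diagram_def)

lemma row_cases: "(r, c) \<in> D0 \<Longrightarrow> r = r1 \<or> r = r2"
  using rows by (auto simp: nonempty_rows_def row_cols_def)

lemma r1_pos: "1 \<le> r1"
proof -
  have "row_cols D0 r1 \<noteq> {}"
    using rows by (auto simp: nonempty_rows_def)
  then show ?thesis
    using diagram by (auto simp: row_cols_def is_diagram_def)
qed

lemma finite_cols: "finite both" "finite A"
  by (rule finite_subset[OF _ finite_row_cols[OF finite_D0, of r1]];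
      auto simp: Col_both_def Col_left_def Col_only_def row_cols_def)+

lemma card_col_rows_D0:
  "card (col_rows D0 c) =
    (if c \<in> both then 2 else if (r1, c) \<in> D0 \<or> (r2, c) \<in> D0 then 1 else 0)"
proof -
  have "col_rows D0 c = (if (r1, c) \<in> D0 then {r1} else {}) \<union> (if (r2, c) \<in> D0 then {r2} else {})"
    using row_cases by (auto simp: col_rows_def)
  then show ?thesis
    using less by (auto simp: Col_both_def)
qed

section \<open>The shape of a minimal diagram\<close>

lemma Min_KD_D:
  assumes "F \<in> Min_KD D0"
  shows "kohnert_step\<^sup>*\<^sup>* D0 F" "finite F" "card (col_rows F c) = card (col_rows D0 c)"
proof -
  show *: "kohnert_step\<^sup>*\<^sup>* D0 F"
    using assms by (simp add: Min_KD_def KD_def)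
  show "finite F" "card (col_rows F c) = card (col_rows D0 c)"
    using kohnert_steps_finite[OF * finite_D0] kohnert_steps_card_col_rows[OF * finite_D0] .
qed

lemma kohnert_steps_rows_pos:
  assumes "kohnert_step\<^sup>*\<^sup>* D0 F" "(r, c) \<in> F"
  shows "1 \<le> r"
  using assms
proof (induction arbitrary: r c rule: rtranclp_induct)
  case base
  then show ?case using diagram by (auto simp: is_diagram_def)
next
  case (step E F)
  have fin: "finite E"
    using kohnert_steps_finite[OF step.hyps(1) finite_D0] .
  show ?case
  proof (cases "F = E")
    case False
    show ?thesis
      by (rule kohnert_stepE[OF step.hyps(2) fin False]) (use step in auto)
  qed (use step in auto)
qed

text \<open>The last cell of row \<open>r\<close> stands on a full column, which then holds at least
  \<open>r\<close> cells; moves preserve column sizes, and these are at most 2.\<close>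

lemma Min_KD_rows:
  assumes F: "F \<in> Min_KD D0" and rc: "(r, c) \<in> F"
  shows "r = 1 \<or> r = 2"
proof -
  have pos: "1 \<le> r"
    using kohnert_steps_rows_pos[OF Min_KD_D(1)[OF F] rc] .
  have ne: "row_cols F r \<noteq> {}"
    using rc by (auto simp: row_cols_def)
  define d where "d = Max (row_cols F r)"
  have "{1..r} \<subseteq> col_rows F d"
    using Min_KD_stuck[OF F finite_D0 pos ne] by (auto simp: col_rows_def d_def)
  then have "card {1..r} \<le> card (col_rows F d)"
    by (intro card_mono finite_col_rows Min_KD_D(2)[OF F])
  also have "\<dots> \<le> 2"
    by (simp add: Min_KD_D(3)[OF F] card_col_rows_D0)
  finally show ?thesis using pos by auto
qed

text \<open>Column sizes are preserved and only rows 1 and 2 remain; the freedom left is the row of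
  a single.\<close>

lemma Min_KD_col_rows:
  assumes F: "F \<in> Min_KD D0"
  shows "c \<in> both \<Longrightarrow> col_rows F c = {1, 2}"
    and "c \<notin> both \<Longrightarrow> (r1, c) \<in> D0 \<or> (r2, c) \<in> D0 \<Longrightarrow> col_rows F c = {1} \<or> col_rows F c = {2}"
    and "(r1, c) \<notin> D0 \<Longrightarrow> (r2, c) \<notin> D0 \<Longrightarrow> col_rows F c = {}"
proof -
  have sub: "col_rows F c \<subseteq> {1, 2}"
    using Min_KD_rows[OF F] by (auto simp: col_rows_def)
  have card: "card (col_rows F c) = card (col_rows D0 c)"
    by (rule Min_KD_D(3)[OF F])
  show "col_rows F c = {1, 2}" if "c \<in> both"
    using sub card that by (intro card_subset_eq) (auto simp: card_col_rows_D0)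
  show "col_rows F c = {1} \<or> col_rows F c = {2}"
    if "c \<notin> both" "(r1, c) \<in> D0 \<or> (r2, c) \<in> D0"
  proof -
    have "card (col_rows F c) = 1"
      using that card by (simp add: card_col_rows_D0)
    then show ?thesis
      using sub by (auto simp: card_1_singleton_iff)
  qed
  show "col_rows F c = {}" if "(r1, c) \<notin> D0" "(r2, c) \<notin> D0"
    using that card finite_col_rows[OF Min_KD_D(2)[OF F], of c]
    by (simp add: card_col_rows_D0 Col_both_def)
qed

text \<open>The last cell of row 2 has a cell below it, so its column belongs to
  \<open>both\<close>.\<close>

lemma Min_KD_row_two:
  assumes F: "F \<in> Min_KD D0" and "(2, c) \<in> F"
  shows "both \<noteq> {}" "c \<le> Max both"
proof -
  have ne: "row_cols F 2 \<noteq> {}"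
    using assms by (auto simp: row_cols_def)
  define d where "d = Max (row_cols F 2)"
  have "(1, d) \<in> F" "(2, d) \<in> F"
    using Min_KD_stuck[OF F finite_D0 _ ne, of 1] Min_KD_stuck[OF F finite_D0 _ ne, of 2]
    by (auto simp: d_def)
  then have "{1, 2} \<subseteq> col_rows F d"
    by (auto simp: col_rows_def)
  then have d: "d \<in> both"
    using Min_KD_col_rows[OF F, of d] by force
  then show "both \<noteq> {}" by blast
  have "c \<le> d"
    using Max_row_cols(2)[OF Min_KD_D(2)[OF F] ne] assms(2) by (simp add: d_def)
  also have "d \<le> Max both"
    using d finite_cols(1) by simp
  finally show "c \<le> Max both" .
qed

lemma A_D:
  assumes "c \<in> A"
  shows "(r1, c) \<in> D0" "(r2, c) \<notin> D0" "c \<notin> both" "both \<noteq> {}" "c < Max both"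
  using assms less by (auto simp: Col_left_def Col_only_def Col_both_def split: if_splits)

lemma B_D:
  assumes "c \<in> B"
  shows "(r2, c) \<in> D0" "(r1, c) \<notin> D0" "c \<notin> both" "both \<noteq> {}" "c < Max both"
  using assms less by (auto simp: Col_left_def Col_only_def Col_both_def split: if_splits)

text \<open>A single in the top row dominates column \<open>Max both\<close>, and that column ends
  with a cell in row 2.\<close>

lemma Min_KD_B:
  assumes F: "F \<in> Min_KD D0" and c: "c \<in> B"
  shows "col_rows F c = {2}"
proof -
  have only: "r = r2" if "(r, c) \<in> D0" for r
    using B_D[OF c] row_cases[OF that] that by auto
  have max: "r \<le> r2" if "(r, d) \<in> D0" for r d
    using row_cases[OF that] less by auto
  have "dominates D0 c c" "dominates D0 c (Max both)"
    unfolding dominates_def using only max by blast+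
  then have dom: "dominates F c (Max both)"
    using kohnert_steps_dominates[OF Min_KD_D(1)[OF F] finite_D0] B_D(5)[OF c] by simp
  have "Max both \<in> both"
    using B_D(4)[OF c] finite_cols by simp
  then have "(2, Max both) \<in> F"
    using Min_KD_col_rows(1)[OF F] by (auto simp: col_rows_def)
  then have "(1, c) \<notin> F"
    using dom by (force simp: dominates_def)
  then show ?thesis
    using Min_KD_col_rows(2)[OF F B_D(3)[OF c]] B_D(1)[OF c] by (auto simp: col_rows_def)
qed

lemma Min_KD_A:
  assumes "F \<in> Min_KD D0" "c \<in> A"
  shows "(2, c) \<in> F \<longleftrightarrow> (1, c) \<notin> F"
proof -
  have "col_rows F c = {1} \<or> col_rows F c = {2}"
    using Min_KD_col_rows(2)[OF assms(1) A_D(3)] A_D(1) assms(2) by blast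
  moreover have "(r, c) \<in> F \<longleftrightarrow> r \<in> col_rows F c" for r
    by (simp add: col_rows_def)
  ultimately show ?thesis
    by (elim disjE) simp_all
qed

text \<open>The right-hand side depends on \<open>F\<close> only through \<open>upper F\<close>,
  which gives injectivity of \<open>upper\<close>.\<close>

lemma Min_KD_col_rows_eq:
  assumes F: "F \<in> Min_KD D0"
  shows "col_rows F c =
    (if c \<in> both then {1, 2}
     else if (r1, c) \<notin> D0 \<and> (r2, c) \<notin> D0 then {}
     else if c \<in> upper F \<or> c \<in> B then {2} else {1})"
proof -
  have "col_rows F c = {1}"
    if c: "c \<notin> both" "(r1, c) \<in> D0 \<or> (r2, c) \<in> D0" "c \<notin> upper F" "c \<notin> B"
  proof -
    \<comment> \<open>A single in row 2 lies strictly left of \<open>Max both\<close>, hence in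
      \<open>A\<close> or \<open>B\<close>; both are excluded.\<close>
    have False if "(2, c) \<in> F"
    proof -
      have ne: "both \<noteq> {}" and "c \<le> Max both"
        using Min_KD_row_two[OF F that] .
      moreover have "Max both \<noteq> c"
        using c(1) ne finite_cols(1) Max_in by metis
      ultimately have "c < Max both" by simp
      then have "c \<in> A \<or> c \<in> B"
        using c(1,2) ne row_cases[of _ c] unfolding Col_left_def Col_only_def Col_both_def by auto
      then show False
        using c(3,4) that by (auto simp: upper_def)
    qed
    then show ?thesis
      using Min_KD_col_rows(2)[OF F c(1,2)] by (auto simp: col_rows_def)
  qed
  moreover have "col_rows F c = {2}" if "c \<in> upper F"
  proof -
    have c: "c \<in> A" "2 \<in> col_rows F c"
      using that by (auto simp: upper_def col_rows_def)
    have "col_rows F c = {1} \<or> col_rows F c = {2}"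
      using Min_KD_col_rows(2)[OF F A_D(3)[OF c(1)]] A_D(1)[OF c(1)] by blast
    then show ?thesis
      using c(2) by (elim disjE) simp_all
  qed
  ultimately show ?thesis
    using Min_KD_col_rows(1,3)[OF F, of c] Min_KD_B[OF F, of c] by meson
qed

lemma inj_on_upper: "inj_on upper (Min_KD D0)"
proof (rule inj_onI)
  fix F G assume "F \<in> Min_KD D0" "G \<in> Min_KD D0" "upper F = upper G"
  then have "col_rows F c = col_rows G c" for c
    using Min_KD_col_rows_eq[of F c] Min_KD_col_rows_eq[of G c] by presburger
  then show "F = G"
    by (auto simp: col_rows_def set_eq_iff)
qed

lemma A_only:
  assumes "c \<in> A" "(r, c) \<in> D0"
  shows "r = r1"
  using A_D(2)[OF assms(1)] row_cases[OF assms(2)] assms(2) by auto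

text \<open>All columns of \<open>A\<close> start with one cell in row \<open>r1\<close>, so each
  dominates those to its right. If the right one ends in row 2, so does the left one.\<close>

lemma upper_initial_segment:
  assumes F: "F \<in> Min_KD D0"
  shows "upper F \<in> initial_segments A"
proof -
  have "x \<in> upper F" if "x \<in> A" "y \<in> upper F" "x \<le> y" for x y
  proof -
    have y: "y \<in> A" "(2, y) \<in> F"
      using that(2) by (auto simp: upper_def)
    have "dominates D0 x x" "dominates D0 x y"
      using A_only[OF that(1)] A_only[OF y(1)] unfolding dominates_def by (metis order.refl)+
    then have "dominates F x y"
      using kohnert_steps_dominates[OF Min_KD_D(1)[OF F] finite_D0 that(3)] by blast
    then have "(1, x) \<notin> F"
      using y(2) by (force simp: dominates_def)
    then show ?thesis
      using Min_KD_A[OF F that(1)] that(1) by (simp add: upper_def)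
  qed
  moreover have "upper F \<subseteq> A"
    by (auto simp: upper_def)
  ultimately show ?thesis
    by (auto simp: initial_segments_def)
qed

section \<open>Reaching every initial segment\<close>

lemma row_one_not_upper:
  assumes "F \<in> Min_KD D0" "kohnert_step\<^sup>*\<^sup>* E F" "finite E" "(1, c) \<in> E"
  shows "c \<notin> upper F"
proof
  assume "c \<in> upper F"
  then have c: "c \<in> A" "(2, c) \<in> F"
    by (auto simp: upper_def)
  \<comment> \<open>A cell in row 1 never moves, while a column of \<open>A\<close> has only one
    cell.\<close>
  then show False
    using kohnert_steps_row_one[OF assms(2,3,4)] Min_KD_A[OF assms(1)] by blast
qed

text \<open>The three lowerings place the cells of \<open>A\<close> left of \<open>m\<close> in row
  2 and the others in row 1. No later move changes this if the diagram finally reached is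
  minimal.\<close>

lemma reach_initial_segment:
  assumes r1: "1 < r1" and ne: "both \<noteq> {}" and m: "m \<le> Max both"
  obtains F where "F \<in> Min_KD D0" "upper F = {x \<in> A. x < m}"
proof -
  define M where "M = Max both"
  have M: "M \<in> both"
    using Max_in[OF finite_cols(1) ne] by (simp add: M_def)
  define E1 where "E1 = lower_cell r1 2 0 ` D0"
  define E2 where "E2 = lower_cell 2 1 m ` E1"
  define E3 where "E3 = lower_cell r2 2 M ` E2"
  have E1: "E1 = {(2, c) |c. (r1, c) \<in> D0} \<union> {(r2, c) |c. (r2, c) \<in> D0}"
    using row_cases less by (force simp: E1_def lower_cell_def image_iff split: if_splits)
  \<comment> \<open>As a union over \<open>E1\<close>, the image splits along the two rows of
    \<open>E1\<close>.\<close>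
  have "E2 = (\<Union>x\<in>E1. {lower_cell 2 1 m x})"
    by (auto simp: E2_def)
  then have E2: "E2 = {(if m \<le> c then 1 else 2, c) |c. (r1, c) \<in> D0} \<union> {(r2, c) |c. (r2, c) \<in> D0}"
    using less r1 unfolding E1 lower_cell_def by (auto split: if_splits)
  have fin: "finite E1" "finite E2" "finite E3"
    using finite_D0 by (auto simp: E1_def E2_def E3_def)
  have "kohnert_step\<^sup>*\<^sup>* D0 E1"
    unfolding E1_def using finite_D0 r1 less row_cases
    by (intro lower_row) fastforce+
  also have "kohnert_step\<^sup>*\<^sup>* E1 E2"
    unfolding E2_def using fin r1 less by (intro lower_row) (auto simp: E1)
  \<comment> \<open>Since \<open>m \<le> M\<close>, the former row \<open>r1\<close> has left row 2
    from column \<open>M\<close> on, so the way down is free.\<close>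
  also have "kohnert_step\<^sup>*\<^sup>* E2 E3"
    unfolding E3_def using fin r1 less m by (intro lower_row) (auto simp: E2 M_def)
  finally have reach: "kohnert_step\<^sup>*\<^sup>* D0 E3" .
  then have "E3 \<in> KD D0"
    by (simp add: KD_def)
  \<comment> \<open>\<open>E3\<close> itself need not be minimal: it may keep cells of row
    \<open>r2\<close> left of \<open>M\<close>.\<close>
  then obtain F where F: "F \<in> Min_KD D0" and steps: "kohnert_step\<^sup>*\<^sup>* E3 F"
    using Min_KD_below finite_D0 by blast
  have E3: "x \<in> E2 \<Longrightarrow> lower_cell r2 2 M x \<in> E3" for x
    by (simp add: E3_def)
  have A_E3: "(if m \<le> c then 1 else 2, c) \<in> E3" if "c \<in> A" for c
    using E3[of "(if m \<le> c then 1 else 2, c)"] A_D(1)[OF that] r1 less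
    by (auto simp: E2 lower_cell_def split: if_splits)
  have single: "r = (if m \<le> c then 1 else 2)" if "c \<in> A" "(r, c) \<in> E3" for r c
  proof -
    have "card (col_rows E3 c) = 1"
      using kohnert_steps_card_col_rows[OF reach finite_D0] A_D[OF that(1)]
      by (simp add: card_col_rows_D0)
    then obtain i where i: "col_rows E3 c = {i}"
      by (auto simp: card_1_singleton_iff)
    have "r \<in> col_rows E3 c" "(if m \<le> c then 1 else 2) \<in> col_rows E3 c"
      using that(2) A_E3[OF that(1)] unfolding col_rows_def by blast+
    then show ?thesis
      unfolding i by blast
  qed
  have M_E3: "r \<le> 2" if "(r, M) \<in> E3" for r
    using that unfolding E3_def E2 by (auto simp: lower_cell_def split: if_splits)
  have "(c \<in> upper F) = (c < m)" if c: "c \<in> A" for c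
  proof (cases "m \<le> c")
    case True
    then have "(1, c) \<in> E3"
      using A_E3[OF c] by simp
    then show ?thesis
      using row_one_not_upper[OF F steps fin(3)] True by simp
  next
    case False
    \<comment> \<open>The single of column \<open>c\<close> is in row 2 and column \<open>M\<close>
      reaches no higher. As column \<open>M\<close> keeps a cell in row 2, the single cannot fall to
      row 1.\<close>
    have "dominates E3 c c" "dominates E3 c M"
      using single[OF c] M_E3 False by (auto simp: dominates_def)
    then have "dominates F c M"
      using kohnert_steps_dominates[OF steps fin(3)] A_D(5)[OF c] by (simp add: M_def)
    moreover have "(2, M) \<in> F"
      using Min_KD_col_rows(1)[OF F M] by (auto simp: col_rows_def)
    ultimately have "(1, c) \<notin> F"
      by (force simp: dominates_def)
    then show ?thesis
      using Min_KD_A[OF F c] c False by (simp add: upper_def)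
  qed
  then have "upper F = {x \<in> A. x < m}"
    by (auto simp: upper_def)
  then show thesis
    using that F by blast
qed

section \<open>Values of \<open>upper\<close> and the count\<close>

lemma upper_image:
  assumes "1 < r1"
  shows "upper ` Min_KD D0 = initial_segments A"
proof
  show "upper ` Min_KD D0 \<subseteq> initial_segments A"
    using upper_initial_segment by blast
  show "initial_segments A \<subseteq> upper ` Min_KD D0"
  proof
    fix S assume S: "S \<in> initial_segments A"
    show "S \<in> upper ` Min_KD D0"
    proof (cases "S = {}")
      case True
      obtain F where F: "F \<in> Min_KD D0" "upper F = {}"
      \<comment> \<open>Without a common column \<open>A\<close> is empty and any minimal diagram
        serves; otherwise the bound 0 selects nothing.\<close>
      proof (cases "both = {}")
        case True
        obtain F where "F \<in> Min_KD D0"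
          using Min_KD_below[OF finite_D0, of D0] by (auto simp: KD_def)
        moreover have "upper F = {}"
          using True by (simp add: upper_def Col_left_def)
        ultimately show thesis by (rule that)
      next
        case False
        then show thesis
          using reach_initial_segment[OF assms False, of 0] that by auto
      qed
      then show ?thesis using True by blast
    next
      case False
      then obtain a where a: "a \<in> A" "S = {x \<in> A. x \<le> a}"
        using S initial_segments_eq[OF finite_cols(2)] by auto
      \<comment> \<open>The bound \<open>Suc a\<close> turns the strict inequality into
        \<open>x \<le> a\<close>.\<close>
      have "Suc a \<le> Max both"
        using A_D(5)[OF a(1)] by simp
      then obtain F where "F \<in> Min_KD D0" "upper F = {x \<in> A. x < Suc a}"
        using reach_initial_segment[OF assms A_D(4)[OF a(1)]] by blast
      then show ?thesis
        using a(2) by (auto simp: less_Suc_eq_le)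
    qed
  qed
qed

text \<open>The cells of \<open>A\<close> are in row 1 from the start. Existence of a minimal
  diagram makes the image nonempty.\<close>

lemma upper_image_row_one:
  assumes "r1 = 1"
  shows "upper ` Min_KD D0 = {{}}"
proof -
  have "c \<notin> upper F" if F: "F \<in> Min_KD D0" for F c
  proof
    assume c: "c \<in> upper F"
    then have "c \<in> A"
      by (simp add: upper_def)
    then have "(1, c) \<in> D0"
      using A_D(1) unfolding assms by blast
    then show False
      using row_one_not_upper[OF F Min_KD_D(1)[OF F] finite_D0] c by blast
  qed
  then have "upper F = {}" if "F \<in> Min_KD D0" for F
    using that by blast
  moreover obtain F where "F \<in> Min_KD D0"
    using Min_KD_below[OF finite_D0, of D0] by (auto simp: KD_def)
  ultimately show ?thesis
    by (auto simp: image_iff)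
qed

lemma card_Min_KD:
  "card (Min_KD D0) = (if r1 > 1 then card A + 1 else 1)"
proof -
  have "card (Min_KD D0) = card (upper ` Min_KD D0)"
    using card_image[OF inj_on_upper] by simp
  \<comment> \<open>By \<open>r1_pos\<close>, the second case is exactly
    \<open>r1 = 1\<close>.\<close>
  then show ?thesis
    using upper_image upper_image_row_one r1_pos card_initial_segments[OF finite_cols(2)]
    by (cases "r1 > 1") auto
qed

end

theorem theorem5p3:
  fixes D0 :: "cell set" and r1 r2 :: nat
  assumes "is_diagram D0"
    and "nonempty_rows D0 = {r1, r2}"
    and "r1 < r2"
  shows "card (Min_KD D0) = (if r1 > 1 then card (Col_left D0 r1 r2 r1) + 1 else 1)"
proof -
  interpret two_row_diagram D0 r1 r2
    using assms by unfold_locales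
  show ?thesis
    by (rule card_Min_KD)
qed

end
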